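(* Let $f$ be holomorphic on the open unit disk $\Delta$, let $0<r<1$ and $K=\overline\Delta_r=\{z:|z|\le r\}$. For $n\ge0$ let $N_K(n,1)$ denote the maximal number (possibly $+\infty$) of zeros on $K$ of functions $f-p$ with $p\in\mathcal R_{n1}$. If $\lim_{n\to\infty}N_K(n,1)/n=\infty$, then either $f$ extends to an entire function, or $f=P/Q$ on $\Delta$, where $P,Q$ are polynomials, $\deg Q=1$ and $Q$ does not divide $P$.
   Context: $\mathcal P_n$ is the space of complex polynomials of degree at most $n$; $\mathcal R_{nm}$ is the set of rational functions $P_n/Q_m$ with $P_n\in\mathcal P_n$, $Q_m\in\mathcal P_m$, $Q_m\not\equiv0$. Zeros are counted with multiplicity. *)

theory Defs
  imports "HOL-Complex_Analysis.Complex_Analysis" "HOL-Computational_Algebra.Polynomial"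
    "HOL-Library.Extended_Real"
begin

text \<open>Multiplicity of a zero of f - P/Q at z (f holomorphic near z, Q nonzero):
  order of the holomorphic function Q*f - P at z minus the order of Q at z
  (negative values, i.e. poles, count as no zero). This does not depend on the
  representation P/Q of the rational function.\<close>
definition zero_mult_rat :: "(complex \<Rightarrow> complex) \<Rightarrow> complex poly \<Rightarrow> complex poly \<Rightarrow> complex \<Rightarrow> nat" where
  "zero_mult_rat f P Q z =
     nat (zorder (\<lambda>w. poly Q w * f w - poly P w) z - int (order z Q))"

definition num_zeros_rat :: "(complex \<Rightarrow> complex) \<Rightarrow> complex poly \<Rightarrow> complex poly \<Rightarrow> real \<Rightarrow> enat" where
  "num_zeros_rat f P Q r =
     (if (\<forall>w\<in>ball 0 1. poly Q w * f w = poly P w) then \<infinity>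
      else enat (\<Sum>z\<in>{z\<in>cball 0 r. 0 < zero_mult_rat f P Q z}. zero_mult_rat f P Q z))"

definition N_K :: "(complex \<Rightarrow> complex) \<Rightarrow> real \<Rightarrow> nat \<Rightarrow> nat \<Rightarrow> enat" where
  "N_K f r n m = Sup {num_zeros_rat f P Q r | P Q.
       degree P \<le> n \<and> degree Q \<le> m \<and> Q \<noteq> 0}"

end

theory Submission
  imports Defs
begin

text \<open>
  Let \<open>a\<^sub>k\<close> be the Taylor coefficients of \<open>f\<close>, let \<open>D\<^sub>p = a\<^sub>p\<^sup>2 - a\<^bsub>p-1\<^esub> a\<^bsub>p+1\<^esub>\<close>, and put \<open>F = Q f - P\<close> with
  \<open>Q = q\<^sub>0 + q\<^sub>1 z\<close> and \<open>deg P < p\<close>. The coefficients of \<open>F\<close> of index \<open>k \<ge> p\<close> are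
  \<open>q\<^sub>0 a\<^sub>k + q\<^sub>1 a\<^bsub>k-1\<^esub>\<close>; by Cramer's rule they are combinations of those of index \<open>p\<close> and \<open>p + 1\<close>, whose
  weights are quotients of 2x2 minors by \<open>D\<^sub>p\<close>. If \<open>f\<close> is neither entire nor rational with denominator
  of degree 1, then for infinitely many \<open>p\<close> these weights grow at most geometrically, so that
  the maximum of \<open>|F|\<close> on a circle of radius \<open>\<rho> > r\<close> is at most \<open>C\<^sup>p\<close> times its
  maximum on \<open>|z| \<le> r\<close>. On the other hand, \<open>N\<close> zeros of \<open>F\<close> in \<open>|z| \<le> r\<close> make the latter maximum at most
  \<open>\<kappa>\<^sup>N\<close> times the former, with \<open>\<kappa> < 1\<close> (divide by Blaschke factors). Hence \<open>N = O(p)\<close> for these \<open>p\<close>.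
\<close>

section \<open>Growth of coefficients and of their 2x2 minors\<close>

text \<open>\<open>D\<^sub>p\<close> is \<open>minor2 a p (p + 1)\<close>. By truncated subtraction the value is junk when an index is \<open>0\<close>;
  only large indices matter.\<close>
definition minor2 :: "(nat \<Rightarrow> complex) \<Rightarrow> nat \<Rightarrow> nat \<Rightarrow> complex" where
  "minor2 a j k = a j * a (k - 1) - a (j - 1) * a k"

lemma norm_minor2_le:
  assumes bnd: "\<And>k. norm (a k) \<le> M * s ^ k" and s: "s \<ge> 1"
  shows "norm (minor2 a j k) \<le> 2 * M\<^sup>2 * s ^ (j + k)"
proof -
  have M: "M \<ge> 0" using bnd[of 0] norm_ge_zero[of "a 0"] by (simp del: norm_ge_zero)
  have prev: "norm (a (i - 1)) \<le> M * s ^ i" for i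
    by (rule order_trans[OF bnd]) (use s M in \<open>auto intro!: mult_left_mono power_increasing\<close>)
  have "norm (minor2 a j k) \<le> norm (a j) * norm (a (k - 1)) + norm (a (j - 1)) * norm (a k)"
    unfolding minor2_def by (metis norm_mult norm_triangle_ineq4)
  also have "\<dots> \<le> (M * s ^ j) * (M * s ^ k) + (M * s ^ j) * (M * s ^ k)"
    using bnd prev M s by (intro add_mono mult_mono) auto
  finally show ?thesis by (simp add: power2_eq_square power_add algebra_simps)
qed

text \<open>Starting at an index where \<open>|a\<^sub>k|\<close> is large both absolutely and relative to \<open>|a\<^bsub>k-1\<^esub>|\<close>, smallness of
  \<open>a\<^sub>k\<^sup>2 - a\<^bsub>k-1\<^esub> a\<^bsub>k+1\<^esub>\<close> nearly preserves the ratio of consecutive terms.\<close>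
lemma eventually_norm_ge_power:
  fixes a :: "nat \<Rightarrow> complex" and c :: real
  assumes small: "\<And>e. e > 0 \<Longrightarrow> \<forall>\<^sub>F p in sequentially. norm (minor2 a p (p + 1)) < e ^ p"
    and c: "c > 0" and freq: "\<exists>\<^sub>F k in sequentially. norm (a k) \<ge> c ^ k"
  shows "\<exists>d. 0 < d \<and> d \<le> 1 \<and> (\<forall>\<^sub>F k in sequentially. norm (a k) \<ge> d ^ k)"
proof -
  \<comment> \<open>The factor 2 between \<open>c\<close> and \<open>c'\<close> gives the
    contradiction that produces the starting index \<open>k\<close>. The factor 2 between
    \<open>c'\<close> and \<open>e\<close> is the room in which the ratio bound \<open>u\<close> may
    decrease.\<close>
  define c' where "c' = min c 1 / 2"
  define e where "e = c' / 2"
  have c': "0 < c'" "2 * c' \<le> c" and e: "0 < e" "e \<le> 1" "c' = 2 * e"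
    using c by (auto simp: c'_def e_def)
  have "e\<^sup>2 / 4 > 0" using e by simp
  \<comment> \<open>With this base, \<open>|D_j| < 4^-j (e^j)^2\<close>, hence
    \<open>|D_j| <= 4^-j |a_j|^2\<close> as soon as \<open>|a_j| >= e^j\<close>.\<close>
  from small[OF this] obtain m0 where m0: "\<And>p. p \<ge> m0 \<Longrightarrow> norm (minor2 a p (p + 1)) < (e\<^sup>2 / 4) ^ p"
    by (auto simp: eventually_sequentially)
  define m where "m = max m0 2"
  \<comment> \<open>Without such an index, induction gives \<open>|a_k| <= L c'^k\<close> for all
    \<open>k >= m\<close>, while \<open>|a_k| >= c^k >= (2 c')^k\<close> for infinitely many
    \<open>k\<close>.\<close>
  have "\<exists>k>m. norm (a k) \<ge> c' ^ k \<and> norm (a k) \<ge> c' * norm (a (k - 1))"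
  proof (rule ccontr)
    assume "\<not> ?thesis"
    hence no: "norm (a k) < c' ^ k \<or> norm (a k) < c' * norm (a (k - 1))" if "k > m" for k
      using that by force
    define L where "L = max 1 (norm (a m) / c' ^ m)"
    have L: "L \<ge> 1" "norm (a m) \<le> L * c' ^ m"
      using c' by (auto simp: L_def max_def field_simps)
    have up: "norm (a k) \<le> L * c' ^ k" if "k \<ge> m" for k
      using that
    proof (induction k rule: dec_induct)
      case base
      then show ?case using L by simp
    next
      case (step k)
      from no[of "Suc k"] step have "norm (a (Suc k)) < c' ^ Suc k \<or> norm (a (Suc k)) < c' * norm (a k)"
        by simp
      then show ?case
      proof
        assume "norm (a (Suc k)) < c' ^ Suc k"
        also have "\<dots> \<le> L * c' ^ Suc k"
          using L c' mult_right_mono[of 1 L "c' ^ Suc k"] by simp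
        finally show ?thesis by simp
      next
        assume "norm (a (Suc k)) < c' * norm (a k)"
        also have "\<dots> \<le> c' * (L * c' ^ k)" using step c' by (intro mult_left_mono) auto
        finally show ?thesis by (simp add: algebra_simps)
      qed
    qed
    obtain k1 where k1: "L < 2 ^ k1" using real_arch_pow[of 2 L] by auto
    from freq obtain k where k: "k \<ge> max m k1" "norm (a k) \<ge> c ^ k"
      unfolding frequently_sequentially by blast
    have "(2 * c') ^ k \<le> c ^ k" using c' by (intro power_mono) auto
    also have "\<dots> \<le> L * c' ^ k" using k up[of k] by auto
    also have "\<dots> < 2 ^ k * c' ^ k"
    proof -
      have "(2::real) ^ k1 \<le> 2 ^ k" using k by (intro power_increasing) auto
      with k1 have "L < 2 ^ k" by linarith
      thus ?thesis using c' by (intro mult_strict_right_mono) auto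
    qed
    finally show False by (simp add: power_mult_distrib)
  qed
  then obtain k where k: "k > m" "norm (a k) \<ge> c' ^ k" "norm (a k) \<ge> c' * norm (a (k - 1))"
    by blast
  \<comment> \<open>The ratio bound starts at no more than \<open>2 * e = c'\<close> and never falls
    below \<open>e\<close>. Its decrement \<open>e / 2^(j+1)\<close> is what
    \<open>\<theta> * u j\<close>, the relative loss in one step, can cost at most.\<close>
  define u :: "nat \<Rightarrow> real" where "u j = e * (1 + (1/2) ^ j)" for j
  have u: "e \<le> u j" "u j \<le> 2 * e" for j
    using e by (auto simp: u_def power_le_one)
  have main: "norm (a j) \<ge> e ^ j \<and> norm (a j) \<ge> u j * norm (a (j - 1))" if "j \<ge> k" for j
    using that
  proof (induction j rule: dec_induct)
    case base
    have "e ^ k \<le> c' ^ k" using e by (intro power_mono) auto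
    moreover have "u k * norm (a (k - 1)) \<le> c' * norm (a (k - 1))"
      using u[of k] e by (intro mult_right_mono) auto
    ultimately show ?case using k by linarith
  next
    case (step j)
    define \<theta> :: real where "\<theta> = (1/4) ^ j"
    \<comment> \<open>\<open>j >= 2\<close> makes \<open>4^-j <= 2^-(j+2)\<close>; this is why
      \<open>m\<close> was taken at least 2.\<close>
    have j: "j \<ge> 2" "j \<ge> m0" using step k by (auto simp: m_def)
    have \<theta>: "\<theta> \<le> (1/2) ^ (j + 2)" "\<theta> > 0" "\<theta> < 1"
    proof -
      have "\<theta> = (1/2) ^ (j + j)" by (simp add: \<theta>_def power_add flip: power_mult_distrib)
      also have "\<dots> \<le> (1/2) ^ (j + 2)" using j by (intro power_decreasing) auto
      finally show "\<theta> \<le> (1/2) ^ (j + 2)" .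
      show "\<theta> < 1" using j by (auto simp: \<theta>_def power_less_one_iff)
    qed (auto simp: \<theta>_def)
    have aj: "norm (a j) > 0" using step.IH e by (smt (verit) zero_less_power)
    have D: "norm (minor2 a j (j + 1)) \<le> \<theta> * (norm (a j))\<^sup>2"
    proof -
      have "norm (minor2 a j (j + 1)) \<le> (e\<^sup>2 / 4) ^ j" using m0[of j] j by simp
      also have "\<dots> = \<theta> * (e ^ j)\<^sup>2"
        by (simp add: \<theta>_def power_divide power_mult_distrib field_simps flip: power_mult)
      also have "\<dots> \<le> \<theta> * (norm (a j))\<^sup>2"
        using step.IH e \<theta> by (intro mult_left_mono power_mono) auto
      finally show ?thesis .
    qed
    have "a j * a j = minor2 a j (j + 1) + a (j - 1) * a (Suc j)" by (simp add: minor2_def)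
    hence "(norm (a j))\<^sup>2 \<le> norm (minor2 a j (j + 1)) + norm (a (j - 1)) * norm (a (Suc j))"
      by (metis norm_mult norm_triangle_ineq power2_eq_square)
    with D have low: "(1 - \<theta>) * (norm (a j))\<^sup>2 \<le> norm (a (j - 1)) * norm (a (Suc j))"
      by (simp add: algebra_simps)
    have pos: "norm (a (j - 1)) > 0"
    proof (rule ccontr)
      assume "\<not> ?thesis"
      hence "(1 - \<theta>) * (norm (a j))\<^sup>2 \<le> 0" using low by simp
      moreover have "(1 - \<theta>) * (norm (a j))\<^sup>2 > 0" using \<theta> aj by (intro mult_pos_pos) auto
      ultimately show False by linarith
    qed
    have us: "u (Suc j) \<le> (1 - \<theta>) * u j"
    proof -
      have "\<theta> * u j \<le> (1/2) ^ (j + 2) * (2 * e)" using \<theta> u[of j] e by (intro mult_mono) auto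
      thus ?thesis by (simp add: u_def algebra_simps)
    qed
    have "norm (a (j - 1)) * (u (Suc j) * norm (a j)) \<le> norm (a (j - 1)) * ((1 - \<theta>) * u j * norm (a j))"
      using us by (intro mult_left_mono mult_right_mono) auto
    also have "\<dots> = (1 - \<theta>) * norm (a j) * (u j * norm (a (j - 1)))" by simp
    also have "\<dots> \<le> (1 - \<theta>) * norm (a j) * norm (a j)"
      using step.IH \<theta> by (intro mult_left_mono) auto
    also have "\<dots> \<le> norm (a (j - 1)) * norm (a (Suc j))" using low by (simp add: power2_eq_square)
    finally have res: "u (Suc j) * norm (a j) \<le> norm (a (Suc j))" using pos by simp
    have "e ^ Suc j \<le> u (Suc j) * norm (a j)"
      using step.IH e u[of "Suc j"] by (auto intro!: mult_mono)
    with res show ?case by simp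
  qed
  show ?thesis
    using e main by (intro exI[of _ e]) (auto simp: eventually_sequentially)
qed

text \<open>If \<open>|D\<^sub>p|\<^bsup>1/p\<^esup>\<close> does not tend to 0, any \<open>p\<close> with \<open>|D\<^sub>p| \<ge> c\<^sup>p\<close> will do. Otherwise the ratios
  \<open>a\<^sub>k / a\<^bsub>k-1\<^esub>\<close> differ successively by \<open>- D\<^sub>k / (a\<^sub>k a\<^bsub>k-1\<^esub>)\<close>, and \<open>p\<close> is chosen to maximise \<open>|D\<^sub>p| S\<^sup>p\<close> over
  a tail, for a large constant \<open>S\<close>.\<close>
lemma infinitely_many_dominant_minors:
  fixes a :: "nat \<Rightarrow> complex"
  assumes bnd: "\<And>k. norm (a k) \<le> M * s ^ k" and s: "s \<ge> 1"
    and not_entire: "\<not> (\<forall>c>0. \<forall>\<^sub>F k in sequentially. norm (a k) < c ^ k)"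
    and not_geometric: "\<not> (\<exists>x. \<forall>\<^sub>F k in sequentially. a (Suc k) = x * a k)"
  shows "\<exists>K C. 0 \<le> K \<and> 0 < C \<and> (\<forall>m. \<exists>p\<ge>m. minor2 a p (p + 1) \<noteq> 0 \<and>
           (\<forall>k\<ge>p. norm (minor2 a k (p + 1)) \<le> K * C ^ p * s ^ k * norm (minor2 a p (p + 1)) \<and>
                  norm (minor2 a k p) \<le> K * C ^ p * s ^ k * norm (minor2 a p (p + 1))))"
proof (cases "\<forall>c>0. \<forall>\<^sub>F p in sequentially. norm (minor2 a p (p + 1)) < c ^ p")
  case False
  then obtain c where c: "c > 0" and fr: "\<exists>\<^sub>F p in sequentially. norm (minor2 a p (p + 1)) \<ge> c ^ p"
    by (auto simp: not_eventually not_less)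
  \<comment> \<open>The crude growth \<open>s^(k+q)\<close> of a minor, compared with
    \<open>|D_p| >= c^p\<close>, gives the base \<open>C = s / c\<close>; the case
    \<open>q = p + 1\<close> costs the extra factor \<open>s\<close> in \<open>K\<close>.\<close>
  have *: "norm (minor2 a k q) \<le> (2 * M\<^sup>2 * s) * (s / c) ^ p * s ^ k * norm (minor2 a p (p + 1))"
    if "norm (minor2 a p (p + 1)) \<ge> c ^ p" "q \<le> p + 1" for p q k
  proof -
    have "norm (minor2 a k q) \<le> 2 * M\<^sup>2 * s ^ (k + q)" by (rule norm_minor2_le[OF bnd s])
    also have "\<dots> \<le> 2 * M\<^sup>2 * s ^ (k + p + 1)"
      using s that by (intro mult_left_mono power_increasing) auto
    also have "\<dots> = (2 * M\<^sup>2 * s) * (s / c) ^ p * s ^ k * c ^ p"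
      using c by (simp add: power_add power_divide)
    also have "\<dots> \<le> (2 * M\<^sup>2 * s) * (s / c) ^ p * s ^ k * norm (minor2 a p (p + 1))"
      using that s c by (intro mult_left_mono) auto
    finally show ?thesis .
  qed
  have nz: "minor2 a p (p + 1) \<noteq> 0" if "norm (minor2 a p (p + 1)) \<ge> c ^ p" for p
    using that c zero_less_power[OF c, of p] by (metis norm_zero not_less)
  show ?thesis
  proof (rule exI[of _ "2 * M\<^sup>2 * s"], rule exI[of _ "s / c"], intro conjI allI)
    fix m
    from fr obtain p where "p \<ge> m" "norm (minor2 a p (p + 1)) \<ge> c ^ p"
      by (auto simp: frequently_sequentially)
    thus "\<exists>p\<ge>m. minor2 a p (p + 1) \<noteq> 0 \<and>
           (\<forall>k\<ge>p. norm (minor2 a k (p + 1)) \<le> 2 * M\<^sup>2 * s * (s / c) ^ p * s ^ k * norm (minor2 a p (p + 1)) \<and>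
                  norm (minor2 a k p) \<le> 2 * M\<^sup>2 * s * (s / c) ^ p * s ^ k * norm (minor2 a p (p + 1)))"
      using * nz by (intro exI[of _ p]) auto
  qed (use s c in auto)
next
  case True
  define D where "D p = minor2 a p (p + 1)" for p
  from not_entire obtain c where "c > 0" "\<exists>\<^sub>F k in sequentially. norm (a k) \<ge> c ^ k"
    by (auto simp: not_eventually not_less)
  with True eventually_norm_ge_power[of a c] obtain d where d: "0 < d" "d \<le> 1"
    and "\<forall>\<^sub>F k in sequentially. norm (a k) \<ge> d ^ k" by blast
  then obtain k0 where k0: "\<And>k. k \<ge> k0 \<Longrightarrow> norm (a k) \<ge> d ^ k"
    by (auto simp: eventually_sequentially)
  have nz: "a k \<noteq> 0" if "k \<ge> k0" for k
    using k0[OF that] zero_less_power[OF d(1), of k] by auto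
  define y where "y k = a k / a (k - 1)" for k
  have ydiff: "y (Suc i) - y i = - D i / (a i * a (i - 1))" if "i > k0" for i
    using nz[of i] nz[of "i - 1"] that by (simp add: y_def D_def minor2_def field_simps)
  have minor_y: "minor2 a j k = a (j - 1) * a (k - 1) * (y j - y k)" if "j > k0" "k > k0" for j k
    using nz[of "j - 1"] nz[of "k - 1"] that by (simp add: y_def minor2_def field_simps)
  \<comment> \<open>If \<open>D\<close> vanished from some index on, the ratios \<open>y\<close>
    would be constant there and the coefficients geometric.\<close>
  have D_nz: "\<exists>i\<ge>m. D i \<noteq> 0" for m
  proof (rule ccontr)
    assume no: "\<not> ?thesis"
    define n where "n = max m (Suc k0)"
    have const: "y k = y n" if "k \<ge> n" for k using that
    proof (induction k rule: dec_induct)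
      case (step k)
      hence "D k = 0" "k > k0" using no by (auto simp: n_def)
      thus ?case using ydiff[of k] step by simp
    qed auto
    have "a (Suc k) = y n * a k" if "k \<ge> n" for k
      using nz[of k] const[of "Suc k"] that by (simp add: y_def n_def field_simps)
    with not_geometric show False by (auto simp: eventually_sequentially)
  qed
  \<comment> \<open>\<open>d^2\<close> compensates the denominators
    \<open>|a_i a_(i-1)| >= d^(2i)\<close>; the 2 leaves a factor \<open>2^-i\<close> in each
    increment of \<open>y\<close>, so that the increments can be summed.\<close>
  define S where "S = 2 / d\<^sup>2"
  have S: "S > 0" using d by (simp add: S_def)
  have ex_max: "\<exists>p\<ge>m. D p \<noteq> 0 \<and> (\<forall>i\<ge>p. norm (D i) * S ^ i \<le> norm (D p) * S ^ p)" for m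
  proof -
    define t where "t i = norm (D i) * S ^ i" for i
    obtain i0 where i0: "i0 \<ge> m" "D i0 \<noteq> 0" using D_nz by blast
    hence v: "t i0 > 0" using S by (simp add: t_def)
    \<comment> \<open>In the present case \<open>|D_i| < (1 / (2 * S))^i\<close> eventually, so
      \<open>t i\<close> tends to 0. The supremum over the tail is therefore attained among finitely
      many indices.\<close>
    have "1 / (2 * S) > 0" using S by simp
    with True have ev1: "\<forall>\<^sub>F i in sequentially. norm (D i) < (1 / (2 * S)) ^ i" by (simp add: D_def)
    have "(\<lambda>i. (1/2) ^ i :: real) \<longlonglongrightarrow> 0" by (rule LIMSEQ_power_zero) auto
    with v have ev2: "\<forall>\<^sub>F i in sequentially. (1/2) ^ i < t i0" by (auto dest: order_tendstoD(2))
    from ev1 ev2 have "\<forall>\<^sub>F i in sequentially. t i < t i0"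
    proof eventually_elim
      case (elim i)
      have "t i \<le> (1 / (2 * S)) ^ i * S ^ i"
        unfolding t_def using elim S by (intro mult_right_mono) auto
      also have "\<dots> = (1/2) ^ i" using S by (simp add: power_divide power_mult_distrib)
      finally show ?case using elim by simp
    qed
    then obtain n where n: "\<And>i. i \<ge> n \<Longrightarrow> t i < t i0" by (auto simp: eventually_sequentially)
    define A where "A = {i. m \<le> i \<and> i < Suc (max n i0)}"
    have A: "finite A" "i0 \<in> A" using i0 by (auto simp: A_def)
    hence "Max (t ` A) \<in> t ` A" by (intro Max_in) auto
    then obtain p where p: "p \<in> A" "t p = Max (t ` A)" by auto
    have mx: "t i \<le> t p" if "i \<in> A" for i using A p that by auto
    have "t i \<le> t p" if "i \<ge> m" for i
    proof (cases "i \<in> A")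
      case False
      hence "t i < t i0" using that by (intro n) (auto simp: A_def)
      thus ?thesis using mx[of i0] A by simp
    qed (rule mx)
    moreover have "t p > 0" using mx[of i0] A v by simp
    hence "D p \<noteq> 0" by (auto simp: t_def)
    ultimately show ?thesis using p by (intro exI[of _ p]) (auto simp: A_def t_def)
  qed
  have M: "M \<ge> 0" using bnd[of 0] norm_ge_zero[of "a 0"] by (simp del: norm_ge_zero)
  have prev: "norm (a (i - 1)) \<le> M * s ^ i" for i
    by (rule order_trans[OF bnd]) (use s M in \<open>auto intro!: mult_left_mono power_increasing\<close>)
  show ?thesis
  \<comment> \<open>These constants come from multiplying \<open>M * s^k\<close>,
    \<open>M * s^p\<close> and \<open>2 * E\<close>, where \<open>E = 2 |D_p| / d^(2p)\<close>
    bounds the distance of every later ratio from \<open>y p\<close>.\<close>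
  proof (rule exI[of _ "4 * M\<^sup>2"], rule exI[of _ "s / d\<^sup>2"], intro conjI allI)
    fix m
    obtain p where p: "p \<ge> max m (Suc k0)" "D p \<noteq> 0"
      "\<And>i. i \<ge> p \<Longrightarrow> norm (D i) * S ^ i \<le> norm (D p) * S ^ p"
      using ex_max by blast
    have ystep: "norm (y (Suc i) - y i) \<le> norm (D p) * S ^ p * (1/2) ^ i" if "i \<ge> p" for i
    proof -
      have "d ^ i * d ^ i \<le> norm (a i) * norm (a (i - 1))"
      proof (intro mult_mono)
        show "d ^ i \<le> norm (a i)" using k0[of i] p that by auto
        have "d ^ i \<le> d ^ (i - 1)" using d by (intro power_decreasing) auto
        also have "\<dots> \<le> norm (a (i - 1))" using k0[of "i - 1"] p that by auto
        finally show "d ^ i \<le> norm (a (i - 1))" .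
      qed (use d in auto)
      hence "norm (D i) / (norm (a i) * norm (a (i - 1))) \<le> norm (D i) / (d ^ i * d ^ i)"
        using d by (intro frac_le) auto
      hence "norm (y (Suc i) - y i) \<le> norm (D i) / (d ^ i * d ^ i)"
        using ydiff[of i] p that by (simp add: norm_divide norm_mult)
      also have "\<dots> = norm (D i) * S ^ i * (1/2) ^ i"
        by (simp add: S_def power_divide power_mult_distrib power2_eq_square)
      also have "\<dots> \<le> norm (D p) * S ^ p * (1/2) ^ i"
        using p(3)[OF that] by (intro mult_right_mono) auto
      finally show ?thesis .
    qed
    define E where "E = 2 * norm (D p) * (1 / d\<^sup>2) ^ p"
    \<comment> \<open>The last factor is the geometric sum of \<open>2^-i\<close> over
      \<open>p <= i < k\<close>.\<close>
    have tel: "norm (y k - y p) \<le> norm (D p) * S ^ p * (2 * (1/2) ^ p - 2 * (1/2) ^ k)" if "k \<ge> p" for k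
      using that
    proof (induction k rule: dec_induct)
      case (step k)
      have "norm (y (Suc k) - y p) \<le> norm (y (Suc k) - y k) + norm (y k - y p)"
        using norm_triangle_ineq[of "y (Suc k) - y k" "y k - y p"] by simp
      also have "\<dots> \<le> norm (D p) * S ^ p * (1/2) ^ k
          + norm (D p) * S ^ p * (2 * (1/2) ^ p - 2 * (1/2) ^ k)"
        by (intro add_mono ystep step)
      finally show ?case by (simp add: algebra_simps)
    qed auto
    have tel': "norm (y k - y p) \<le> E" if "k \<ge> p" for k
    proof -
      have "norm (y k - y p) \<le> norm (D p) * S ^ p * (2 * (1/2) ^ p)"
        by (rule order_trans[OF tel[OF that]]) (use S in \<open>auto intro!: mult_left_mono\<close>)
      also have "\<dots> = E" by (simp add: E_def S_def power_divide)
      finally show ?thesis .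
    qed
    have E0: "E \<ge> 0" by (simp add: E_def)
    have bound: "norm (minor2 a k q) \<le> 4 * M\<^sup>2 * (s / d\<^sup>2) ^ p * s ^ k * norm (D p)"
      if k: "k \<ge> p" and q: "q = p \<or> q = p + 1" for k q
    proof -
      have "norm (y k - y q) \<le> norm (y k - y p) + norm (y q - y p)"
        by (metis norm_triangle_ineq4 diff_diff_eq2 diff_add_cancel)
      also have "\<dots> \<le> 2 * E" using tel'[of k] tel'[of q] k q by auto
      finally have yy: "norm (y k - y q) \<le> 2 * E" .
      have aq: "norm (a (q - 1)) \<le> M * s ^ p" using prev[of p] bnd[of p] q by auto
      have "norm (minor2 a k q) = norm (a (k - 1)) * norm (a (q - 1)) * norm (y k - y q)"
        using minor_y[of k q] p k q by (auto simp: norm_mult)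
      also have "\<dots> \<le> (M * s ^ k) * (M * s ^ p) * (2 * E)"
        using prev[of k] aq yy M s E0 by (intro mult_mono) auto
      also have "\<dots> = 4 * M\<^sup>2 * (s / d\<^sup>2) ^ p * s ^ k * norm (D p)"
        by (simp add: E_def power_divide power2_eq_square)
      finally show ?thesis .
    qed
    show "\<exists>p\<ge>m. minor2 a p (p + 1) \<noteq> 0 \<and>
           (\<forall>k\<ge>p. norm (minor2 a k (p + 1)) \<le> 4 * M\<^sup>2 * (s / d\<^sup>2) ^ p * s ^ k * norm (minor2 a p (p + 1)) \<and>
                  norm (minor2 a k p) \<le> 4 * M\<^sup>2 * (s / d\<^sup>2) ^ p * s ^ k * norm (minor2 a p (p + 1)))"
      using p bound by (intro exI[of _ p]) (auto simp: D_def)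
  qed (use s d in auto)
qed

section \<open>Zeros and Blaschke factors\<close>

text \<open>The zeros are split off one at a time. Near the new point \<open>x\<close> the earlier
  factors \<open>W\<close> do not vanish, so \<open>g / W\<close> continues
  \<open>G / (w - x)^m\<close> across \<open>x\<close>.\<close>

lemma holomorphic_factor_zeros:
  fixes F :: "complex \<Rightarrow> complex"
  assumes U: "open U" "F holomorphic_on U" and Z: "finite Z" "Z \<subseteq> U"
    and loc: "\<And>z. z \<in> Z \<Longrightarrow> \<exists>s>0. \<exists>g. g holomorphic_on ball z s \<and> (\<forall>w\<in>ball z s. F w = (w - z) ^ m z * g w)"
  shows "\<exists>G. G holomorphic_on U \<and> (\<forall>w\<in>U. F w = (\<Prod>z\<in>Z. (w - z) ^ m z) * G w)"
  using Z loc
proof (induction Z rule: finite_induct)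
  case empty
  then show ?case using U by auto
next
  case (insert x Z)
  define W where "W w = (\<Prod>z\<in>Z. (w - z) ^ m z)" for w
  from insert obtain G where G: "G holomorphic_on U" "\<And>w. w \<in> U \<Longrightarrow> F w = W w * G w"
    by (auto simp: W_def)
  from insert.prems obtain s g where s: "s > 0" and g: "g holomorphic_on ball x s"
    "\<And>w. w \<in> ball x s \<Longrightarrow> F w = (w - x) ^ m x * g w"
    by (meson insertI1)
  obtain d where d: "d > 0" "\<And>z. z \<in> Z \<Longrightarrow> z \<noteq> x \<Longrightarrow> d \<le> dist x z"
    using finite_set_avoid[OF insert.hyps(1), of x] by blast
  obtain t where t: "t > 0" "ball x t \<subseteq> U"
    using U insert.prems by (meson insert_subset open_contains_ball)
  define e where "e = min s (min d t)"
  have e: "e > 0" "e \<le> s" "ball x e \<subseteq> U" using s d t by (auto simp: e_def)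
  have W0: "W w \<noteq> 0" if "w \<in> ball x e" for w
    using that d(2) insert.hyps by (force simp: W_def e_def)
  have Whol: "W holomorphic_on A" for A unfolding W_def by (intro holomorphic_intros)
  define H where "H w = (if w \<in> ball x e then g w / W w else G w / (w - x) ^ m x)" for w
  have loc: "G w = (w - x) ^ m x * (g w / W w)" if "w \<in> ball x e" for w
    using G(2)[of w] g(2)[of w] W0[OF that] that e by (auto simp: field_simps)
  have H_eq: "H w = G w / (w - x) ^ m x" if "w \<noteq> x" for w
    using loc[of w] that by (auto simp: H_def)
  have "H holomorphic_on ball x e"
  proof (rule holomorphic_transform)
    show "(\<lambda>w. g w / W w) holomorphic_on ball x e"
      by (intro holomorphic_intros Whol W0 holomorphic_on_subset[OF g(1)]) (use e in auto)
  qed (simp add: H_def)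
  moreover have "H holomorphic_on (U - {x})"
  proof (rule holomorphic_transform)
    show "(\<lambda>w. G w / (w - x) ^ m x) holomorphic_on U - {x}"
      by (intro holomorphic_intros holomorphic_on_subset[OF G(1)]) auto
  qed (simp add: H_eq)
  ultimately have "H holomorphic_on (ball x e \<union> (U - {x}))"
    using U by (intro holomorphic_on_Un) auto
  moreover have "ball x e \<union> (U - {x}) = U" using e by (auto simp: subset_iff)
  ultimately have "H holomorphic_on U" by simp
  moreover have "F w = (\<Prod>z\<in>insert x Z. (w - z) ^ m z) * H w" if "w \<in> U" for w
  proof -
    have "G w = (w - x) ^ m x * H w"
      using H_eq[of w] loc[of w] e by (cases "w = x") (auto simp: H_def)
    thus ?thesis using G(2)[OF that] insert.hyps by (simp add: W_def)
  qed
  ultimately show ?case by blast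
qed

text \<open>For \<open>|w| = \<rho>\<close> the last product vanishes, so the Blaschke factor has
  modulus 1 there; inside the circle the product measures how far below 1 it lies.\<close>

lemma norm_blaschke_identity:
  fixes a w :: complex and \<rho> :: real
  shows "(norm (of_real (\<rho>\<^sup>2) - cnj a * w))\<^sup>2
       = (\<rho> * norm (w - a))\<^sup>2 + (\<rho>\<^sup>2 - (norm a)\<^sup>2) * (\<rho>\<^sup>2 - (norm w)\<^sup>2)"
  unfolding power_mult_distrib cmod_power2 by (simp add: algebra_simps power2_eq_square)

text \<open>A bound, not the sharp one, for the modulus of a Blaschke factor of the disk of radius
  \<open>\<rho>\<close> when point and zero both lie in the disk of radius \<open>r\<close>. The
  denominator is at most \<open>2 \<rho>^2\<close> in modulus, and the last product in the identity
  above is at least \<open>(\<rho>^2 - r^2)^2\<close>.\<close>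

definition blaschke_rate :: "real \<Rightarrow> real \<Rightarrow> real" where
  "blaschke_rate r \<rho> = sqrt (1 - ((\<rho>\<^sup>2 - r\<^sup>2) / (2 * \<rho>\<^sup>2))\<^sup>2)"

lemma blaschke_rate_bounds:
  assumes "0 < r" "r < \<rho>"
  shows "0 \<le> blaschke_rate r \<rho>" "blaschke_rate r \<rho> < 1"
proof -
  define q where "q = (\<rho>\<^sup>2 - r\<^sup>2) / (2 * \<rho>\<^sup>2)"
  have "r\<^sup>2 < \<rho>\<^sup>2" using assms by (intro power_strict_mono) auto
  hence "q > 0" using assms by (auto simp: q_def intro!: divide_pos_pos)
  moreover have "q \<le> 1" using assms by (simp add: q_def field_simps)
  ultimately have "q\<^sup>2 \<le> 1" "q\<^sup>2 > 0" by (auto simp: power_le_one)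
  thus "0 \<le> blaschke_rate r \<rho>" "blaschke_rate r \<rho> < 1"
    by (auto simp: blaschke_rate_def simp flip: q_def)
qed

lemma blaschke_factor_le:
  fixes a w :: complex
  assumes r: "0 < r" "r < \<rho>" and aw: "norm a \<le> r" "norm w \<le> r"
  shows "\<rho> * norm (w - a) \<le> blaschke_rate r \<rho> * norm (of_real (\<rho>\<^sup>2) - cnj a * w)"
proof -
  define X where "X = norm (of_real (\<rho>\<^sup>2) - cnj a * w)"
  define q where "q = (\<rho>\<^sup>2 - r\<^sup>2) / (2 * \<rho>\<^sup>2)"
  have rr: "r\<^sup>2 < \<rho>\<^sup>2" using r by (intro power_strict_mono) auto
  have "X \<le> \<rho>\<^sup>2 + norm a * norm w"
    unfolding X_def by (rule order_trans[OF norm_triangle_ineq4]) (simp add: norm_mult norm_power)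
  also have "norm a * norm w \<le> r * r" using aw r by (intro mult_mono) auto
  finally have X: "X \<le> 2 * \<rho>\<^sup>2" using rr by (simp add: power2_eq_square)
  have "(norm a)\<^sup>2 \<le> r\<^sup>2" "(norm w)\<^sup>2 \<le> r\<^sup>2" using aw by (auto intro: power_mono)
  hence "(\<rho>\<^sup>2 - r\<^sup>2) * (\<rho>\<^sup>2 - r\<^sup>2) \<le> (\<rho>\<^sup>2 - (norm a)\<^sup>2) * (\<rho>\<^sup>2 - (norm w)\<^sup>2)"
    using rr by (intro mult_mono) auto
  moreover have "(q * X)\<^sup>2 \<le> (\<rho>\<^sup>2 - r\<^sup>2)\<^sup>2"
  proof (rule power_mono)
    have "q * X \<le> q * (2 * \<rho>\<^sup>2)" using X rr r by (intro mult_left_mono) (auto simp: q_def)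
    thus "q * X \<le> \<rho>\<^sup>2 - r\<^sup>2" using r by (simp add: q_def)
    show "0 \<le> q * X" using rr by (auto simp: q_def X_def)
  qed
  ultimately have "(\<rho> * norm (w - a))\<^sup>2 \<le> X\<^sup>2 - (q * X)\<^sup>2"
    using norm_blaschke_identity[of \<rho> a w] by (simp add: X_def power2_eq_square)
  also have "\<dots> = (1 - q\<^sup>2) * X\<^sup>2" by (simp add: algebra_simps power_mult_distrib)
  finally have "\<rho> * norm (w - a) \<le> sqrt ((1 - q\<^sup>2) * X\<^sup>2)"
    by (rule real_le_rsqrt)
  also have "\<dots> = blaschke_rate r \<rho> * X"
    by (simp add: real_sqrt_mult blaschke_rate_def q_def X_def)
  finally show ?thesis by (simp add: X_def)
qed

text \<open>Replacing each factor \<open>w - z\<close> by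
  \<open>(\<rho>^2 - cnj z * w) / \<rho>\<close> leaves the modulus on \<open>|w| = \<rho>\<close>
  unchanged, so the maximum principle bounds the new function \<open>H\<close> by \<open>B\<close>.
  Returning to \<open>F\<close> inside the smaller disk gains one factor
  \<open>blaschke_rate r \<rho>\<close> per zero.\<close>

lemma norm_le_blaschke_rate_power:
  fixes F :: "complex \<Rightarrow> complex"
  assumes r: "0 < r" "r < \<rho>" "\<rho> < R"
    and F: "F holomorphic_on ball 0 R" "\<exists>w\<in>ball 0 R. F w \<noteq> 0"
    and Z: "finite Z" "Z \<subseteq> cball 0 r" and m: "\<And>z. z \<in> Z \<Longrightarrow> m z \<le> nat (zorder F z)"
    and B: "\<And>w. norm w = \<rho> \<Longrightarrow> norm (F w) \<le> B" and w: "norm w \<le> r"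
  shows "norm (F w) \<le> blaschke_rate r \<rho> ^ (\<Sum>z\<in>Z. m z) * B"
proof -
  have "\<exists>s>0. \<exists>g. g holomorphic_on ball z s \<and> (\<forall>w\<in>ball z s. F w = (w - z) ^ m z * g w)"
    if z: "z \<in> Z" for z
  proof -
    define n where "n = nat (zorder F z)"
    have zU: "z \<in> ball 0 R" using z Z r by auto
    from zorder_exist_zero[OF F(1) open_ball connected_ball zU F(2)] obtain s where
      s: "s > 0" "zor_poly F z holomorphic_on cball z s"
         "\<And>w. w \<in> cball z s \<Longrightarrow> F w = zor_poly F z w * (w - z) ^ n"
      unfolding n_def by blast
    \<comment> \<open>\<open>m z\<close> may be smaller than the order; the surplus power of
      \<open>w - z\<close> goes into the cofactor.\<close>
    have n: "n = m z + (n - m z)" using m[OF z] by (simp add: n_def)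
    have "(\<lambda>w. (w - z) ^ (n - m z) * zor_poly F z w) holomorphic_on ball z s"
      by (intro holomorphic_intros holomorphic_on_subset[OF s(2)]) auto
    moreover have "F w = (w - z) ^ m z * ((w - z) ^ (n - m z) * zor_poly F z w)"
      if "w \<in> ball z s" for w
      using s(3)[of w] that n by (metis ball_subset_cball mult.assoc mult.commute power_add subsetD)
    ultimately show ?thesis using s(1) by blast
  qed
  moreover have "Z \<subseteq> ball 0 R" using Z r by auto
  ultimately obtain G where G: "G holomorphic_on ball 0 R"
    "\<And>w. w \<in> ball 0 R \<Longrightarrow> F w = (\<Prod>z\<in>Z. (w - z) ^ m z) * G w"
    using holomorphic_factor_zeros[OF open_ball F(1) Z(1), of m] by blast
  define H where "H w = (\<Prod>z\<in>Z. ((of_real (\<rho>\<^sup>2) - cnj z * w) / of_real \<rho>) ^ m z) * G w" for w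
  have H: "H holomorphic_on ball 0 R"
    unfolding H_def by (intro holomorphic_intros G) (use r in auto)
  have nF: "norm (F w) = (\<Prod>z\<in>Z. norm (w - z) ^ m z) * norm (G w)" if "w \<in> ball 0 R" for w
    using G(2)[OF that] by (simp add: norm_mult norm_power prod_norm[symmetric])
  have nH: "norm (H w) = (\<Prod>z\<in>Z. (norm (of_real (\<rho>\<^sup>2) - cnj z * w) / \<rho>) ^ m z) * norm (G w)" for w
    using r by (simp add: H_def norm_mult norm_power norm_divide prod_norm[symmetric])
  have "norm (H w) \<le> B"
  proof (rule maximum_modulus_frontier[of H "cball 0 \<rho>"])
    show "H holomorphic_on interior (cball 0 \<rho>)"
      by (rule holomorphic_on_subset[OF H]) (use r in auto)
    show "continuous_on (closure (cball 0 \<rho>)) H"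
      by (rule holomorphic_on_imp_continuous_on, rule holomorphic_on_subset[OF H]) (use r in auto)
    fix z :: complex assume "z \<in> frontier (cball 0 \<rho>)"
    hence z: "norm z = \<rho>" using r by (simp add: frontier_cball)
    have "norm (of_real (\<rho>\<^sup>2) - cnj x * z) / \<rho> = norm (z - x)" for x
    proof -
      have "norm (of_real (\<rho>\<^sup>2) - cnj x * z) = \<rho> * norm (z - x)"
        by (rule power2_eq_imp_eq, subst norm_blaschke_identity) (use z r in auto)
      thus ?thesis using r by simp
    qed
    hence "norm (H z) = norm (F z)" using nF[of z] nH[of z] z r by simp
    thus "norm (H z) \<le> B" using B[OF z] by simp
  qed (use r w in auto)
  have rate: "0 \<le> blaschke_rate r \<rho>" using blaschke_rate_bounds r by blast
  have "norm (F w) = (\<Prod>z\<in>Z. norm (w - z) ^ m z) * norm (G w)" using nF r w by simp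
  also have "\<dots> \<le> (\<Prod>z\<in>Z. (blaschke_rate r \<rho> * (norm (of_real (\<rho>\<^sup>2) - cnj z * w) / \<rho>)) ^ m z) * norm (G w)"
  proof (intro mult_right_mono prod_mono conjI power_mono)
    fix z assume "z \<in> Z"
    hence "\<rho> * norm (w - z) \<le> blaschke_rate r \<rho> * norm (of_real (\<rho>\<^sup>2) - cnj z * w)"
      using blaschke_factor_le r w Z by auto
    thus "norm (w - z) \<le> blaschke_rate r \<rho> * (norm (of_real (\<rho>\<^sup>2) - cnj z * w) / \<rho>)"
      using r by (simp add: field_simps)
  qed auto
  also have "\<dots> = blaschke_rate r \<rho> ^ (\<Sum>z\<in>Z. m z) * norm (H w)"
    unfolding nH power_mult_distrib prod.distrib power_sum by (simp add: mult.assoc)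
  also have "\<dots> \<le> blaschke_rate r \<rho> ^ (\<Sum>z\<in>Z. m z) * B"
    using \<open>norm (H w) \<le> B\<close> rate by (intro mult_left_mono) auto
  finally show ?thesis .
qed

section \<open>Taylor coefficients and growth between two circles\<close>

lemma norm_fps_expansion_le:
  assumes F: "F holomorphic_on ball 0 R" and r: "0 < r" "r < R"
    and B: "\<And>w. norm w = r \<Longrightarrow> norm (F w) \<le> B"
  shows "norm (fps_nth (fps_expansion F 0) k) \<le> B / r ^ k"
proof -
  have "norm ((deriv ^^ k) F 0) \<le> fact k * B / r ^ k"
  proof (rule Cauchy_inequality)
    show "F holomorphic_on ball 0 r" by (rule holomorphic_on_subset[OF F]) (use r in auto)
    show "continuous_on (cball 0 r) F"
      by (rule holomorphic_on_imp_continuous_on, rule holomorphic_on_subset[OF F]) (use r in auto)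
  qed (use r B in auto)
  thus ?thesis by (simp add: fps_expansion_def norm_divide divide_le_eq mult.commute)
qed

text \<open>This carries a bound from radius \<open>r\<close> out to a larger radius
  \<open>\<rho>\<close>. The first \<open>p\<close> terms satisfy Cauchy bounds and grow by at most
  \<open>(\<rho> / r)^p\<close>; the others form a convergent geometric series.\<close>

lemma norm_power_series_le:
  fixes c :: "nat \<Rightarrow> complex"
  assumes sums: "(\<lambda>k. c k * w ^ k) sums y" and w: "norm w = \<rho>"
    and r: "0 < r" "r < \<rho>" and s: "0 \<le> s" "s * \<rho> < 1" and RB: "0 \<le> B" "0 \<le> R"
    and head: "\<And>k. k < p \<Longrightarrow> norm (c k) \<le> B / r ^ k"
    and tail: "\<And>k. k \<ge> p \<Longrightarrow> norm (c k) \<le> R * s ^ k"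
  shows "norm y \<le> real p * (\<rho> / r) ^ p * B + R / (1 - s * \<rho>)"
proof -
  \<comment> \<open>The geometric term is kept also for \<open>k < p\<close>, so that its series can
    be summed from 0.\<close>
  define h where "h k = (if k < p then (\<rho> / r) ^ p * B else 0) + R * (s * \<rho>) ^ k" for k
  have "(\<lambda>k. if k \<in> {..<p} then (\<rho> / r) ^ p * B else 0) sums (\<Sum>k\<in>{..<p}. (\<rho> / r) ^ p * B)"
    by (rule sums_If_finite_set) auto
  moreover have "(\<lambda>k. R * (s * \<rho>) ^ k) sums (R * (1 / (1 - s * \<rho>)))"
    using s r by (intro sums_mult geometric_sums) auto
  ultimately have h: "h sums (real p * (\<rho> / r) ^ p * B + R / (1 - s * \<rho>))"
    unfolding h_def using sums_add[of "\<lambda>k. if k < p then (\<rho> / r) ^ p * B else 0"]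
    by (simp add: mult.assoc)
  have le: "norm (c k * w ^ k) \<le> h k" for k
  proof (cases "k < p")
    case True
    have "norm (c k * w ^ k) \<le> B / r ^ k * \<rho> ^ k"
      unfolding norm_mult norm_power w using r by (intro mult_right_mono head[OF True]) auto
    also have "\<dots> = (\<rho> / r) ^ k * B" by (simp add: power_divide)
    also have "\<dots> \<le> (\<rho> / r) ^ p * B"
      using True r RB by (intro mult_right_mono power_increasing) auto
    also have "\<dots> \<le> h k" using True RB s r by (simp add: h_def)
    finally show ?thesis .
  next
    case False
    hence "norm (c k * w ^ k) \<le> R * s ^ k * \<rho> ^ k"
      using tail[of k] w r by (auto simp: norm_mult norm_power intro!: mult_right_mono)
    thus ?thesis using False by (simp add: h_def power_mult_distrib)
  qed
  have "norm y \<le> suminf h"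
    using norm_suminf_le[OF le sums_summable[OF h]] sums_unique[OF sums] by simp
  thus ?thesis using sums_unique[OF h] by simp
qed

section \<open>The two coefficient patterns that give the conclusion\<close>

lemma entire_extension_if_coeffs_small:
  assumes f: "f holomorphic_on ball 0 1"
    and small: "\<And>c. c > 0 \<Longrightarrow> \<forall>\<^sub>F k in sequentially. norm (fps_nth (fps_expansion f 0) k) < c ^ k"
  shows "\<exists>g. g holomorphic_on UNIV \<and> (\<forall>z\<in>ball 0 1. g z = f z)"
proof -
  define A where "A = fps_expansion f 0"
  have "fps_conv_radius A = \<infinity>"
    unfolding fps_conv_radius_def
  proof (rule conv_radius_inftyI'')
    fix z :: complex
    define c where "c = 1 / (2 * (norm z + 1))"
    have c: "c > 0" "c * norm z \<le> 1/2" by (auto simp: c_def field_simps add_pos_nonneg)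
    show "summable (\<lambda>n. fps_nth A n * z ^ n)"
    proof (rule summable_comparison_test_ev)
      show "\<forall>\<^sub>F n in sequentially. norm (fps_nth A n * z ^ n) \<le> (1/2) ^ n"
        using small[OF c(1)]
      proof eventually_elim
        case (elim n)
        have "norm (fps_nth A n * z ^ n) \<le> c ^ n * norm z ^ n"
          using elim by (auto simp: A_def norm_mult norm_power intro!: mult_right_mono)
        also have "\<dots> \<le> (1/2) ^ n"
          using c unfolding power_mult_distrib[symmetric] by (intro power_mono) auto
        finally show ?case .
      qed
    qed auto
  qed
  hence "eval_fps A holomorphic_on UNIV" by (intro holomorphic_on_eval_fps) auto
  moreover have "f holomorphic_on eball 0 1" using f by (simp add: one_ereal_def)
  hence "eval_fps A z = f z" if "z \<in> ball 0 1" for z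
    using eval_fps_expansion'[of f 0 1 z] that by (simp add: A_def one_ereal_def)
  ultimately show ?thesis by blast
qed

lemma has_fps_expansion_poly: "poly P has_fps_expansion fps_of_poly P" for P :: "complex poly"
  by (simp add: has_fps_expansion_def)

text \<open>Multiplication by \<open>1 - x z\<close> annihilates all high coefficients, so
  \<open>Q f\<close> is a polynomial \<open>P\<close>. If \<open>Q\<close> divides \<open>P\<close>,
  then \<open>f\<close> is itself a polynomial, hence entire; this includes \<open>x = 0\<close>,
  where \<open>Q = 1\<close>.\<close>

lemma rational_if_coeffs_geometric:
  assumes f: "f holomorphic_on ball 0 1"
    and geo: "\<forall>\<^sub>F k in sequentially. fps_nth (fps_expansion f 0) (Suc k) = x * fps_nth (fps_expansion f 0) k"
  shows "(\<exists>g. g holomorphic_on UNIV \<and> (\<forall>z\<in>ball 0 1. g z = f z))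
       \<or> (\<exists>P Q :: complex poly. degree Q = 1 \<and> \<not> Q dvd P
            \<and> (\<forall>z\<in>ball 0 1. f z = poly P z / poly Q z))"
proof -
  define A where "A = fps_expansion f 0"
  define Q where "Q = [:1, -x:]"
  obtain k0 where k0: "\<And>k. k \<ge> k0 \<Longrightarrow> fps_nth A (Suc k) = x * fps_nth A k"
    using geo by (auto simp: eventually_sequentially A_def)
  have A: "f has_fps_expansion A"
    unfolding A_def by (rule has_fps_expansion_fps_expansion[OF _ _ f]) auto
  define P where "P = truncate_fps (Suc k0) (fps_of_poly Q * A)"
  have "fps_nth (fps_of_poly Q * A) k = 0" if k: "k > k0" for k
  proof -
    obtain j where "k = Suc j" "j \<ge> k0" using k by (cases k) auto
    thus ?thesis using k0[of j] by (simp add: Q_def fps_of_poly_pCons ring_distribs mult.assoc)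
  qed
  hence P: "fps_of_poly P = fps_of_poly Q * A"
    unfolding P_def by (auto simp: fps_eq_iff)
  show ?thesis
  proof (cases "Q dvd P")
    case True
    then obtain S where "P = Q * S" by (auto simp: dvd_def)
    hence "fps_of_poly Q * A = fps_of_poly Q * fps_of_poly S" using P by (metis fps_of_poly_mult)
    moreover have "fps_of_poly Q \<noteq> 0" by (simp add: Q_def)
    ultimately have AS: "A = fps_of_poly S" unfolding mult_cancel_left by blast
    have "\<forall>\<^sub>F k in sequentially. norm (fps_nth A k) < c ^ k" if "c > 0" for c :: real
      using eventually_gt_at_top[of "degree S"]
      by eventually_elim (use that in \<open>simp add: AS coeff_eq_0\<close>)
    thus ?thesis using entire_extension_if_coeffs_small[OF f] by (simp add: A_def)
  next
    case False
    have eq: "poly Q z * f z = poly P z" if "z \<in> ball 0 1" for z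
    proof -
      have "(\<lambda>z. poly Q z * f z) has_fps_expansion fps_of_poly P"
        unfolding P by (intro fps_expansion_intros has_fps_expansion_poly A)
      moreover have "(\<lambda>z. poly Q z * f z) holomorphic_on ball 0 1" by (intro holomorphic_intros f)
      ultimately show ?thesis using has_fps_expansion_imp_eval_fps_eq[of _ _ z 1] that by fastforce
    qed
    have x: "x \<noteq> 0"
    proof
      assume "x = 0"
      hence "Q = 1" by (simp add: Q_def)
      thus False using False by simp
    qed
    have Q0: "poly Q z \<noteq> 0" if "z \<in> ball 0 1" for z
    proof
      assume z: "poly Q z = 0"
      hence "poly P z = 0" using eq[OF that] by simp
      hence "[:-z, 1:] dvd P" by (simp add: poly_eq_0_iff_dvd)
      moreover have "Q = smult (-x) [:-z, 1:]" using z by (simp add: Q_def algebra_simps)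
      ultimately show False using False x by (metis neg_equal_0_iff_equal smult_dvd_iff)
    qed
    have "degree Q = 1" using x by (simp add: Q_def)
    moreover have "\<forall>z\<in>ball 0 1. f z = poly P z / poly Q z"
      using eq Q0 by (metis nonzero_mult_div_cancel_left)
    ultimately show ?thesis using False by blast
  qed
qed


section \<open>Bounding the number of zeros for infinitely many degrees\<close>

theorem theorem1p2:
  fixes f :: "complex \<Rightarrow> complex" and r :: real
  assumes "f holomorphic_on ball 0 1"
    and "0 < r" and "r < 1"
    and "((\<lambda>n. ereal_of_enat (N_K f r n 1) / ereal (real n)) \<longlongrightarrow> \<infinity>) sequentially"
  shows "(\<exists>g. g holomorphic_on UNIV \<and> (\<forall>z\<in>ball 0 1. g z = f z))
       \<or> (\<exists>P Q :: complex poly. degree Q = 1 \<and> \<not> Q dvd P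
            \<and> (\<forall>z\<in>ball 0 1. f z = poly P z / poly Q z))"
proof -
  note f = assms(1) and r = assms(2,3) and lim = assms(4)
  define A where "A = fps_expansion f 0"
  define a where "a = fps_nth A"
  show ?thesis
  proof (cases "(\<forall>c>0. \<forall>\<^sub>F k in sequentially. norm (a k) < c ^ k)
              \<or> (\<exists>x. \<forall>\<^sub>F k in sequentially. a (Suc k) = x * a k)")
    case True
    then show ?thesis
      using entire_extension_if_coeffs_small[OF f] rational_if_coeffs_geometric[OF f]
      unfolding a_def A_def by blast
  next
    case False
    \<comment> \<open>\<open>\<rho>\<close> is the midpoint of \<open>r\<close> and 1, and
      \<open>1 / s\<close> that of \<open>\<rho>\<close> and 1. Cauchy's estimate at radius
      \<open>1 / s\<close> gives \<open>|a_k| <= M * s^k\<close>, and \<open>s * \<rho> < 1\<close>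
      makes the tail converge on \<open>|w| = \<rho>\<close>.\<close>
    define \<rho> where "\<rho> = (1 + r) / 2"
    define s where "s = 1 / ((1 + \<rho>) / 2)"
    have \<rho>: "r < \<rho>" "\<rho> < 1" "0 < \<rho>" using r by (auto simp: \<rho>_def)
    have s: "1 < s" "s * \<rho> < 1" using \<rho> by (auto simp: s_def field_simps)
    have "\<exists>M. \<forall>k. norm (a k) \<le> M * s ^ k"
    proof -
      have "compact (f ` sphere 0 ((1 + \<rho>) / 2))"
        by (intro compact_continuous_image holomorphic_on_imp_continuous_on
              holomorphic_on_subset[OF f]) (use \<rho> in auto)
      then obtain M where "\<And>w. norm w = (1 + \<rho>) / 2 \<Longrightarrow> norm (f w) \<le> M"
        by (force simp: bounded_iff dest!: compact_imp_bounded)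
      hence "norm (a k) \<le> M / ((1 + \<rho>) / 2) ^ k" for k
        unfolding a_def A_def by (intro norm_fps_expansion_le[OF f]) (use \<rho> in auto)
      thus ?thesis by (auto simp: s_def power_divide)
    qed
    then obtain M where M: "\<And>k. norm (a k) \<le> M * s ^ k" by blast
    obtain K C where KC: "0 \<le> K" "0 < C"
      and dom: "\<And>m. \<exists>p\<ge>m. minor2 a p (p + 1) \<noteq> 0 \<and>
           (\<forall>k\<ge>p. norm (minor2 a k (p + 1)) \<le> K * C ^ p * s ^ k * norm (minor2 a p (p + 1)) \<and>
                  norm (minor2 a k p) \<le> K * C ^ p * s ^ k * norm (minor2 a p (p + 1)))"
      using infinitely_many_dominant_minors[OF M less_imp_le[OF s(1)]] False by blast
    \<comment> \<open>\<open>X\<close> and \<open>L\<close> anticipate the bound on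
      \<open>|w| = \<rho>\<close>: the head contributes
      \<open>p (\<rho> / r)^p <= (2 \<rho> / r)^p\<close>, the tail a constant times
      \<open>(C / r)^p\<close>.\<close>
    define X where "X = max (2 * \<rho> / r) (C / r)"
    define L where "L = 1 + 2 * K / (r * (1 - s * \<rho>))"
    define \<kappa> where "\<kappa> = blaschke_rate r \<rho>"
    have \<kappa>: "0 \<le> \<kappa>" "\<kappa> < 1" using blaschke_rate_bounds r \<rho> by (auto simp: \<kappa>_def)
    have X: "X \<ge> 1" "X > 0"
    proof -
      have "1 \<le> 2 * \<rho> / r" using r \<rho> by (simp add: field_simps)
      thus "X \<ge> 1" by (simp add: X_def)
      thus "X > 0" by linarith
    qed
    have L: "L > 0" using KC r s by (auto simp: L_def intro!: add_pos_nonneg divide_nonneg_nonneg)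
    \<comment> \<open>More than \<open>N * p\<close> zeros gain
      \<open>\<kappa>^(N p) <= (2 X)^-p\<close>, which beats \<open>X^p\<close> by
      \<open>2^p\<close>; \<open>p0\<close> makes \<open>2^p\<close> exceed
      \<open>L\<close>.\<close>
    obtain N where N: "\<kappa> ^ N < 1 / (2 * X)"
      using real_arch_pow_inv[of "1 / (2 * X)" \<kappa>] X \<kappa> by auto
    obtain p0 where p0: "L < 2 ^ p0" using real_arch_pow[of 2 L] by auto
    from lim have "\<forall>\<^sub>F n in sequentially. ereal_of_enat (N_K f r n 1) / ereal (real n) > ereal (real (2 * N))"
      unfolding tendsto_PInfty by blast
    then obtain n0 where n0: "\<And>n. n \<ge> n0 \<Longrightarrow>
        ereal_of_enat (N_K f r n 1) / ereal (real n) > ereal (real (2 * N))"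
      by (auto simp: eventually_sequentially)
    obtain p where p: "p \<ge> max (n0 + 2) p0" and D: "minor2 a p (p + 1) \<noteq> 0"
      and minors: "\<And>k. k \<ge> p \<Longrightarrow> norm (minor2 a k (p + 1)) \<le> K * C ^ p * s ^ k * norm (minor2 a p (p + 1))"
        "\<And>k. k \<ge> p \<Longrightarrow> norm (minor2 a k p) \<le> K * C ^ p * s ^ k * norm (minor2 a p (p + 1))"
      using dom by blast
    \<comment> \<open>With \<open>deg P <= p - 1\<close>, \<open>P\<close> does not affect the
      coefficients of index at least \<open>p\<close>. Since \<open>p <= 2 * n\<close>, a quotient
      above \<open>2 * N\<close> means more than \<open>N * p\<close> zeros.\<close>
    define n where "n = p - 1"
    have n: "n \<ge> n0" "n \<ge> 1" "p = Suc n" using p by (auto simp: n_def)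
    have "enat (N * p) < N_K f r n 1"
    proof -
      have "ereal (real (2 * N * n)) < ereal_of_enat (N_K f r n 1)"
      proof (cases "N_K f r n 1")
        case (enat j)
        have "real (2 * N) < real j / real n" using n0[OF n(1)] n(2) enat by simp
        thus ?thesis using n(2) enat by (simp add: pos_less_divide_eq)
      qed auto
      hence "enat (2 * N * n) < N_K f r n 1"
        by (metis ereal_of_enat_less_iff ereal_of_enat_simps(1))
      moreover have "N * p \<le> 2 * N * n" using n by simp
      ultimately show ?thesis by (meson enat_ord_simps(1) order_le_less_trans)
    qed
    then obtain P Q where PQ: "degree P \<le> n" "degree Q \<le> 1" "Q \<noteq> 0"
      and zeros: "enat (N * p) < num_zeros_rat f P Q r"
      unfolding N_K_def less_Sup_iff by blast
    define q0 where "q0 = coeff Q 0"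
    define q1 where "q1 = coeff Q 1"
    have Q: "Q = [:q0, q1:]"
      using PQ(2) by (auto simp: poly_eq_iff q0_def q1_def coeff_pCons coeff_eq_0 split: nat.split)
    define F where "F w = poly Q w * f w - poly P w" for w
    have F: "F holomorphic_on ball 0 1" unfolding F_def by (intro holomorphic_intros f)
    define c where "c = fps_nth (fps_expansion F 0)"
    have c: "c k = q0 * a k + q1 * a (k - 1)" if "k \<ge> p" for k
    proof -
      have "f has_fps_expansion A"
        unfolding A_def by (rule has_fps_expansion_fps_expansion[OF _ _ f]) auto
      hence "F has_fps_expansion fps_of_poly Q * A - fps_of_poly P"
        unfolding F_def by (intro fps_expansion_intros has_fps_expansion_poly)
      hence "c k = fps_nth (fps_of_poly Q * A - fps_of_poly P) k"
        unfolding c_def by (simp add: fps_expansion_eqI)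
      moreover have "coeff P k = 0" using PQ(1) that n by (intro coeff_eq_0) auto
      ultimately show ?thesis
        using that n by (simp add: Q fps_of_poly_pCons a_def ring_distribs mult.assoc)
    qed
    have "\<exists>w0\<in>cball 0 r. \<forall>w\<in>cball 0 r. norm (F w) \<le> norm (F w0)"
      by (intro continuous_attains_sup continuous_on_norm holomorphic_on_imp_continuous_on
            holomorphic_on_subset[OF F]) (use r in auto)
    then obtain w0 where w0: "norm w0 \<le> r" "\<And>w. norm w \<le> r \<Longrightarrow> norm (F w) \<le> norm (F w0)"
      by auto
    define \<mu> where "\<mu> = norm (F w0)"
    have c_le: "norm (c k) \<le> \<mu> / r ^ k" for k
      unfolding c_def \<mu>_def by (intro norm_fps_expansion_le[OF F]) (use r w0 in auto)
    \<comment> \<open>If \<open>F\<close> vanished on the small disk, its coefficients of index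
      \<open>p\<close> and \<open>p + 1\<close> would be 0, a homogeneous linear system for
      \<open>q0\<close>, \<open>q1\<close> with determinant \<open>D_p\<close>, which is
      nonzero.\<close>
    have "\<mu> \<noteq> 0"
    proof
      assume "\<mu> = 0"
      hence "c p = 0" "c (p + 1) = 0" using c_le[of p] c_le[of "p + 1"] by auto
      hence 0: "q0 * a p + q1 * a (p - 1) = 0" "q0 * a (p + 1) + q1 * a p = 0"
        using c[of p] c[of "p + 1"] by auto
      have "q0 * minor2 a p (p + 1)
          = a p * (q0 * a p + q1 * a (p - 1)) - a (p - 1) * (q0 * a (p + 1) + q1 * a p)"
           "q1 * minor2 a p (p + 1)
          = a p * (q0 * a (p + 1) + q1 * a p) - a (p + 1) * (q0 * a p + q1 * a (p - 1))"
        by (simp_all add: minor2_def algebra_simps)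
      hence "q0 = 0" "q1 = 0" using D unfolding 0 by auto
      thus False using PQ(3) by (simp add: Q)
    qed
    hence \<mu>: "\<mu> > 0" by (simp add: \<mu>_def)
    define R where "R = 2 * K * C ^ p * (\<mu> / r ^ (p + 1))"
    have R: "R \<ge> 0" using KC \<mu> r by (simp add: R_def)
    have tail: "norm (c k) \<le> R * s ^ k" if k: "k \<ge> p" for k
    proof -
      \<comment> \<open>Cramer's rule: eliminate \<open>q0\<close> and \<open>q1\<close> from the
        expressions for \<open>c p\<close>, \<open>c (p + 1)\<close> and \<open>c k\<close>.\<close>
      have "c k * minor2 a p (p + 1) = minor2 a k (p + 1) * c p - minor2 a k p * c (p + 1)"
        using c[OF k] c[of p] c[of "p + 1"] by (simp add: minor2_def algebra_simps)
      hence "norm (c k) * norm (minor2 a p (p + 1))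
          \<le> norm (minor2 a k (p + 1)) * norm (c p) + norm (minor2 a k p) * norm (c (p + 1))"
        by (metis norm_mult norm_triangle_ineq4)
      also have "\<dots> \<le> (K * C ^ p * s ^ k * norm (minor2 a p (p + 1))) * (\<mu> / r ^ (p + 1))
          + (K * C ^ p * s ^ k * norm (minor2 a p (p + 1))) * (\<mu> / r ^ (p + 1))"
      proof (intro add_mono mult_mono minors k c_le)
        have "\<mu> / r ^ p \<le> \<mu> / r ^ (p + 1)"
          using r \<mu> by (intro divide_left_mono power_decreasing) auto
        thus "norm (c p) \<le> \<mu> / r ^ (p + 1)" using c_le[of p] by linarith
      qed (use KC s in auto)
      also have "\<dots> = (R * s ^ k) * norm (minor2 a p (p + 1))" by (simp add: R_def)
      finally show ?thesis using D by simp
    qed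
    have circle: "norm (F w) \<le> L * X ^ p * \<mu>" if w: "norm w = \<rho>" for w
    proof -
      have "F has_fps_expansion fps_expansion F 0"
        by (rule has_fps_expansion_fps_expansion[OF _ _ F]) auto
      hence "(\<lambda>k. c k * w ^ k) sums F w"
        unfolding c_def by (rule has_fps_expansion_imp_sums_complex[where r = 1])
          (use F w \<rho> in \<open>auto simp: one_ereal_def\<close>)
      hence "norm (F w) \<le> real p * (\<rho> / r) ^ p * \<mu> + R / (1 - s * \<rho>)"
        by (rule norm_power_series_le[OF _ w]) (use r \<rho> s \<mu> R c_le tail in auto)
      also have "real p * (\<rho> / r) ^ p * \<mu> \<le> X ^ p * \<mu>"
      proof (intro mult_right_mono)
        have "real p * (\<rho> / r) ^ p \<le> 2 ^ p * (\<rho> / r) ^ p"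
          using r \<rho> of_nat_less_two_power[of p, where ?'a = real] by (intro mult_right_mono) auto
        also have "\<dots> = (2 * \<rho> / r) ^ p" by (simp flip: power_mult_distrib)
        also have "\<dots> \<le> X ^ p" using r \<rho> by (intro power_mono) (auto simp: X_def)
        finally show "real p * (\<rho> / r) ^ p \<le> X ^ p" .
      qed (use \<mu> in auto)
      also have "R / (1 - s * \<rho>) = 2 * K / (r * (1 - s * \<rho>)) * (C / r) ^ p * \<mu>"
        by (simp add: R_def power_divide)
      also have "\<dots> \<le> 2 * K / (r * (1 - s * \<rho>)) * X ^ p * \<mu>"
        using KC r s \<mu> by (intro mult_right_mono mult_left_mono power_mono) (auto simp: X_def)
      also have "X ^ p * \<mu> + \<dots> = L * X ^ p * \<mu>" by (simp add: L_def algebra_simps)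
      finally show ?thesis by simp
    qed
    define m where "m = zero_mult_rat f P Q"
    define Z where "Z = {z \<in> cball 0 r. 0 < m z}"
    \<comment> \<open>This rules out the value \<open>\<infinity>\<close> of
      \<open>num_zeros_rat\<close>, so \<open>zeros\<close> speaks of a genuine sum.\<close>
    have Fnz: "\<exists>w\<in>ball 0 1. F w \<noteq> 0"
      using \<mu> w0(1) r by (intro bexI[of _ w0]) (auto simp: \<mu>_def)
    hence zeros': "N * p < (\<Sum>z\<in>Z. m z)"
      using zeros by (auto simp: num_zeros_rat_def Z_def m_def F_def split: if_splits)
    \<comment> \<open>A sum over an infinite set is 0 by convention, so a positive sum forces
      finiteness.\<close>
    hence "finite Z" by (metis not_less_zero sum.infinite)
    have "norm (F w0) \<le> \<kappa> ^ (\<Sum>z\<in>Z. m z) * (L * X ^ p * \<mu>)"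
      unfolding \<kappa>_def
      \<comment> \<open>Subtracting the order of \<open>Q\<close> can only lower the multiplicity,
        so \<open>m z\<close> is at most \<open>nat (zorder F z)\<close>, as required.\<close>
      by (rule norm_le_blaschke_rate_power[OF _ _ _ F Fnz \<open>finite Z\<close>])
         (use r \<rho> circle w0 in \<open>auto simp: Z_def m_def zero_mult_rat_def F_def\<close>)
    also have "\<dots> \<le> (\<kappa> ^ N) ^ p * (L * X ^ p * \<mu>)"
      using zeros' \<kappa> L X \<mu> by (intro mult_right_mono) (auto simp flip: power_mult intro!: power_decreasing)
    also have "\<dots> \<le> (1 / (2 * X)) ^ p * (L * X ^ p * \<mu>)"
      using N \<kappa> L X \<mu> by (intro mult_right_mono power_mono) auto
    also have "\<dots> = L / 2 ^ p * \<mu>" using X by (simp add: power_divide power_mult_distrib)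
    also have "\<dots> < 1 * \<mu>"
    proof (intro mult_strict_right_mono \<mu>)
      have "(2::real) ^ p0 \<le> 2 ^ p" using p by (intro power_increasing) auto
      with p0 have "L < 2 ^ p" by linarith
      thus "L / 2 ^ p < 1" by simp
    qed
    finally show ?thesis by (simp add: \<mu>_def)
  qed
qed

end
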